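(* Let $Q$ be any quasiorder and let $\mathcal{L}(\mathcal{N})$ be the Borel base in the Baire space $\mathcal{N}=\omega^\omega$. Then for every $u\in\mathbb{T}_\sigma$ the level $\mathcal{L}(\mathcal{N},u)$ has a Wadge complete $Q$-partition, i.e. there is $B\in\mathcal{L}(\mathcal{N},u)$ such that $A\le_W B$ for every $A\in\mathcal{L}(\mathcal{N},u)$.
   Context: Trees. $\omega^*$ is the set of finite strings over $\omega$, $\varepsilon$ the empty string, $\sqsubseteq$ the prefix order. A tree is a non-empty prefix-closed $T\subseteq\omega^*$; it is well founded if it has no infinite path, and infinite-branching if every non-leaf $\tau\in T$ has $\tau i\in T$ for all $i<\omega$. Terms. For a quasiorder $Q$, $\mathbb{T}_\sigma$ is the set of variable-free terms defined inductively from constants $q\in Q$, unary symbols $s_\alpha$ ($\alpha<\omega_1$) and $\omega$-ary symbols $F_q$ ($q\in Q$) and $F_\alpha$ ($\alpha<\omega_1$), all symbols being distinct. To each $u\in\mathbb{T}_\sigma$ one associates an infinite-branching well founded tree $T$ with a labeling $t$ of its nodes by terms, written $T(u)=(T,t)$: $T(q)$ and $T(s_\alpha(u))$ are the one-node tree $\{\varepsilon\}$ labeled by $q$, resp. by $s_\alpha(u)$; $T(F_q(u_0,u_1,\ldots))$ has root labeled $q$, and its labeled subtree above the node $i$ is $T(u_i)$ for each $i\ge0$; $T(F_\alpha(u_0,u_1,\ldots))$ has root labeled $s_\alpha(u_0)$, and its labeled subtree above the node $i$ is $T(u_{i+1})$ for each $i\ge0$. Bases. A base in a set $X$ is a sequence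 $\mathcal{L}(X)=\{\mathcal{L}_\alpha(X)\}_{\alpha<\omega_1}$ of subsets of $P(X)$, each closed under countable unions and finite intersections, such that for $\alpha<\beta$ all sets of $\mathcal{L}_\alpha$ and their complements belong to $\mathcal{L}_\beta$. The $\beta$-shift is the base $\mathcal{L}^\beta(X)=\{\mathcal{L}_{\beta+\alpha}(X)\}_{\alpha<\omega_1}$; for $U\subseteq X$, the $U$-restriction $\mathcal{L}(U)$ is the base in $U$ with levels $\{U\cap S\mid S\in\mathcal{L}_\alpha(X)\}$. The Borel base in $X$ is $\{\mathbf{\Sigma}^0_{1+\alpha}(X)\}_{\alpha<\omega_1}$ (levels of the Borel hierarchy, $\mathbf{\Sigma}^0_1$ being the class of open sets). Families. For a well founded tree $T$, a $T$-family $\{U_\tau\}_{\tau\in T}$ of subsets of $X$ is monotone if $U_\tau\supseteq U_{\tau'}$ whenever $\tau\sqsubseteq\tau'$ in $T$; its components are $\tilde U_\tau=U_\tau\setminus\bigcup\{U_{\tau'}\mid\tau\sqsubset\tau'\in T\}$. The notions "$F$ is a $u$-family in $\mathcal{L}(X)$" and "$F$ determines $A:X\to Q$" are defined by induction, simultaneously for all bases: (i) the only $q$-family is $\{X\}$, and it determines exactly the constant function $\lambda x.q$; (ii) an $s_\alpha(u)$-family in $\mathcal{L}(X)$ is a $u$-family in $\mathcal{L}^{\omega^\alpha}(X)$, and it determines $A$ iff it determines $A$ as a $u$-family in $\mathcal{L}^{\omega^\alpha}(X)$; (iii) if $u=F_q(u_0,\ldots)$ or $u=F_\alpha(u_0,\ldots)$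 and $T(u)=(T,t)$, a $u$-family is a pair $(\{U_\tau\}_{\tau\in T},\{F_\tau\}_{\tau\in T})$ where $\{U_\tau\}$ is a monotone $T$-family of $\mathcal{L}_0(X)$-sets with $U_\varepsilon=X$ and each $F_\tau$ is a $t(\tau)$-family in $\mathcal{L}(\tilde U_\tau)$; it determines $A$ iff $F_\tau$ determines $A|_{\tilde U_\tau}$ for every $\tau\in T$. $\mathcal{L}(X,u)$ is the set of all $A:X\to Q$ determined by some $u$-family in $\mathcal{L}(X)$. Wadge reducibility. For $A,B:\mathcal{N}\to Q$, $A\le_W B$ means that there is a continuous $f:\mathcal{N}\to\mathcal{N}$ with $A(x)\le_Q B(f(x))$ for all $x$. *)

theory Defs
  imports "HOL-Analysis.Analysis" "HOL-Library.Countable_Set_Type" "HOL-Library.Sublist"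
begin

section \<open>Countable ordinals\<close>

unbundle cardinal_syntax

text \<open>The ordinals below $\omega_1$, realised as the elements of a well-order of type
  $\omega_1 = \omega^+$. The lemmas \<open>countable_lessThan_omega1\<close> and
  \<open>uncountable_UNIV_omega1\<close> determine the order type.\<close>

typedef omega1 = "Field (cardSuc natLeq)"
  using Field_cardSuc_not_empty[OF natLeq_Card_order] by blast

lemma Well_order_cardSuc_natLeq: "Well_order (cardSuc natLeq)"
  by (rule cardSuc_Well_order[OF natLeq_Card_order])

instantiation omega1 :: linorder
begin

definition less_eq_omega1 :: "omega1 \<Rightarrow> omega1 \<Rightarrow> bool" where
  "a \<le> b \<longleftrightarrow> (Rep_omega1 a, Rep_omega1 b) \<in> cardSuc natLeq"

definition less_omega1 :: "omega1 \<Rightarrow> omega1 \<Rightarrow> bool" where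
  "(a :: omega1) < b \<longleftrightarrow> a \<le> b \<and> a \<noteq> b"

instance
proof
  note wo = Well_order_cardSuc_natLeq
  have r: "refl_on (Field (cardSuc natLeq)) (cardSuc natLeq)"
    and t: "trans (cardSuc natLeq)" and an: "antisym (cardSuc natLeq)"
    and tot: "total_on (Field (cardSuc natLeq)) (cardSuc natLeq)"
    using wo unfolding well_order_on_def linear_order_on_def partial_order_on_def
      preorder_on_def by auto
  fix x y z :: omega1
  show le_refl: "x \<le> x"
    using r Rep_omega1[of x] by (auto simp: less_eq_omega1_def refl_on_def)
  show le_trans: "x \<le> y \<Longrightarrow> y \<le> z \<Longrightarrow> x \<le> z"
    using t by (auto simp: less_eq_omega1_def dest: transD)
  have asym: "x = y" if "x \<le> y" "y \<le> x" for x y :: omega1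
    using an that by (auto simp: less_eq_omega1_def Rep_omega1_inject dest: antisymD)
  show "x \<le> y \<Longrightarrow> y \<le> x \<Longrightarrow> x = y"
    by (rule asym)
  show "x < y \<longleftrightarrow> x \<le> y \<and> \<not> y \<le> x"
    using asym le_refl by (auto simp: less_omega1_def)
  show "x \<le> y \<or> y \<le> x"
    using tot Rep_omega1[of x] Rep_omega1[of y] le_refl
    by (cases "x = y") (auto simp: less_eq_omega1_def total_on_def Rep_omega1_inject)
qed

end

instance omega1 :: wellorder
proof (rule wf_wellorderI)
  have "{(x :: omega1, y). x < y} = inv_image (cardSuc natLeq - Id) Rep_omega1"
    by (auto simp: inv_image_def less_omega1_def less_eq_omega1_def Rep_omega1_inject)
  moreover have "wf (cardSuc natLeq - Id)"
    using Well_order_cardSuc_natLeq by (simp add: well_order_on_def)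
  ultimately show "wf {(x :: omega1, y). x < y}"
    by simp
qed intro_classes

lemma countable_lessThan_omega1: "countable {..<a :: omega1}"
proof -
  let ?U = "underS (cardSuc natLeq) (Rep_omega1 a)"
  have "|?U| <o cardSuc natLeq"
    by (rule card_of_underS[OF cardSuc_Card_order[OF natLeq_Card_order] Rep_omega1])
  then have "|?U| \<le>o natLeq"
    using cardSuc_ordLeq_ordLess[OF natLeq_Card_order card_of_Card_order] by blast
  then have "countable ?U"
    by (simp add: countable_card_le_natLeq)
  moreover have "Rep_omega1 ` {..<a} \<subseteq> ?U"
    by (auto simp: underS_def less_omega1_def less_eq_omega1_def Rep_omega1_inject)
  ultimately have "countable (Rep_omega1 ` {..<a})"
    by (rule countable_subset[rotated])
  then show ?thesis
    by (rule countable_image_inj_on) (simp add: inj_on_def Rep_omega1_inject)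
qed

lemma uncountable_UNIV_omega1: "uncountable (UNIV :: omega1 set)"
proof
  assume "countable (UNIV :: omega1 set)"
  then have "countable (Rep_omega1 ` UNIV)"
    by (rule countable_image)
  then have "countable (Field (cardSuc natLeq))"
    using type_definition.Rep_range[OF type_definition_omega1] by simp
  then have "|Field (cardSuc natLeq)| \<le>o natLeq"
    by (simp add: countable_card_le_natLeq)
  then have "cardSuc natLeq \<le>o natLeq"
    using card_of_Field_ordIso[OF cardSuc_Card_order[OF natLeq_Card_order]]
      ordIso_ordLeq_trans ordIso_symmetric by blast
  then show False
    using cardSuc_greater[OF natLeq_Card_order] not_ordLess_ordLeq by blast
qed

unbundle no cardinal_syntax

text \<open>Hence the least upper bounds in the following definitions exist.\<close>

lemma countable_bounded_omega1:
  fixes C :: "omega1 set"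
  assumes "countable C"
  shows "\<exists>b. \<forall>a\<in>C. a < b"
proof (rule ccontr)
  assume *: "\<not> ?thesis"
  have "UNIV = (\<Union>a\<in>C. insert a {..<a})"
  proof (intro set_eqI iffI)
    fix b :: omega1
    obtain a where "a \<in> C" "b \<le> a"
      using * by (meson not_less)
    then show "b \<in> (\<Union>a\<in>C. insert a {..<a})"
      by (auto simp: le_less)
  qed simp
  moreover have "countable (\<Union>a\<in>C. insert a {..<a})"
    using assms countable_lessThan_omega1 by auto
  ultimately show False
    using uncountable_UNIV_omega1 by simp
qed

instantiation omega1 :: "{zero, one}"
begin

definition zero_omega1 :: omega1 where "0 = (LEAST x :: omega1. True)"

definition one_omega1 :: omega1 where "1 = (LEAST x :: omega1. 0 < x)"

instance ..

end

definition omega :: omega1 where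
  "omega = (LEAST x. 0 < x \<and> (\<forall>y<x. \<exists>z<x. y < z))"

text \<open>Ordinal addition, multiplication and exponentiation to base $\omega$:
  $\alpha+\beta = \sup(\{\alpha\}\cup\{\alpha+\gamma+1 \mid \gamma<\beta\})$,
  $\alpha\cdot\beta = \sup\{\alpha\cdot\gamma+\alpha \mid \gamma<\beta\}$,
  $\omega^\beta = \sup(\{1\}\cup\{\omega^\gamma\cdot\omega \mid \gamma<\beta\})$.\<close>

function oadd :: "omega1 \<Rightarrow> omega1 \<Rightarrow> omega1" where
  "oadd a b = (LEAST x. a \<le> x \<and> (\<forall>c. c < b \<longrightarrow> oadd a c < x))"
  by auto
termination
  by (relation "inv_image {(x, y). x < y} snd") (rule wf_inv_image[OF wf], simp add: inv_image_def)

declare oadd.simps [simp del]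

function omult :: "omega1 \<Rightarrow> omega1 \<Rightarrow> omega1" where
  "omult a b = (LEAST x. \<forall>c. c < b \<longrightarrow> oadd (omult a c) a \<le> x)"
  by auto
termination
  by (relation "inv_image {(x, y). x < y} snd") (rule wf_inv_image[OF wf], simp add: inv_image_def)

declare omult.simps [simp del]

function omega_pow :: "omega1 \<Rightarrow> omega1" where
  "omega_pow b = (LEAST x. 1 \<le> x \<and> (\<forall>c. c < b \<longrightarrow> omult (omega_pow c) omega \<le> x))"
  by auto
termination
  by (relation "{(x, y). x < y}") (rule wf, simp)

declare omega_pow.simps [simp del]


lemma oadd_bounds:
  "a \<le> oadd a b" "c < b \<Longrightarrow> oadd a c < oadd a b"
proof -
  have "countable (insert a (oadd a ` {..<b}))"
    using countable_lessThan_omega1 by simp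
  from countable_bounded_omega1[OF this]
  obtain x where "a \<le> x \<and> (\<forall>c. c < b \<longrightarrow> oadd a c < x)"
    by (simp only: ball_simps lessThan_iff Ball_def insert_iff image_iff) (blast intro: less_imp_le)
  then have "a \<le> oadd a b \<and> (\<forall>c. c < b \<longrightarrow> oadd a c < oadd a b)"
    unfolding oadd.simps[of a b] by (rule LeastI)
  then show "a \<le> oadd a b" "c < b \<Longrightarrow> oadd a c < oadd a b"
    by auto
qed

lemma omega_pow_bounds:
  "1 \<le> omega_pow b" "c < b \<Longrightarrow> omult (omega_pow c) omega \<le> omega_pow b"
proof -
  have "countable (insert 1 ((\<lambda>c. omult (omega_pow c) omega) ` {..<b}))"
    using countable_lessThan_omega1 by simp
  from countable_bounded_omega1[OF this]
  obtain x where "1 \<le> x \<and> (\<forall>c. c < b \<longrightarrow> omult (omega_pow c) omega \<le> x)"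
    by (simp only: ball_simps lessThan_iff Ball_def insert_iff image_iff) (blast intro: less_imp_le)
  then have "1 \<le> omega_pow b \<and> (\<forall>c. c < b \<longrightarrow> omult (omega_pow c) omega \<le> omega_pow b)"
    unfolding omega_pow.simps[of b] by (rule LeastI)
  then show "1 \<le> omega_pow b" "c < b \<Longrightarrow> omult (omega_pow c) omega \<le> omega_pow b"
    by auto
qed

lemma omult_bound:
  "c < b \<Longrightarrow> oadd (omult a c) a \<le> omult a b"
proof -
  have "countable ((\<lambda>c. oadd (omult a c) a) ` {..<b})"
    using countable_lessThan_omega1 by simp
  from countable_bounded_omega1[OF this]
  obtain x where "\<forall>c. c < b \<longrightarrow> oadd (omult a c) a \<le> x"
    by (simp only: ball_simps lessThan_iff Ball_def insert_iff image_iff) (blast intro: less_imp_le)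
  then have "\<forall>c. c < b \<longrightarrow> oadd (omult a c) a \<le> omult a b"
    unfolding omult.simps[of a b] by (rule LeastI)
  then show "c < b \<Longrightarrow> oadd (omult a c) a \<le> omult a b"
    by auto
qed

lemma zero_le_omega1: "0 \<le> (a :: omega1)"
  unfolding zero_omega1_def by (rule Least_le) simp

lemma zero_less_one_omega1: "0 < (1 :: omega1)"
proof -
  obtain b where "0 < (b :: omega1)"
    using countable_bounded_omega1[of "{0}"] by auto
  then show ?thesis
    unfolding one_omega1_def by (rule LeastI)
qed

lemma omega_limit: "0 < omega \<and> (\<forall>y<omega. \<exists>z<omega. y < z)"
proof -
  have "\<exists>b. a < b" for a :: omega1
    using countable_bounded_omega1[of "{a}"] by auto
  then obtain s :: "omega1 \<Rightarrow> omega1" where s: "\<And>a. a < s a"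
    by metis
  define C where "C = range (\<lambda>n. (s ^^ n) 0)"
  have C: "a < s a" "a \<in> C \<Longrightarrow> s a \<in> C" for a
  proof -
    show "a < s a" by (rule s)
    assume "a \<in> C"
    then obtain n where "a = (s ^^ n) 0" by (auto simp: C_def)
    then have "s a = (s ^^ Suc n) 0" by simp
    then show "s a \<in> C" unfolding C_def by (rule range_eqI)
  qed
  define x where "x = (LEAST x. \<forall>c\<in>C. c < x)"
  have "\<exists>x. \<forall>c\<in>C. c < x"
    by (rule countable_bounded_omega1) (simp add: C_def)
  then have x: "\<forall>c\<in>C. c < x"
    unfolding x_def by (rule LeastI_ex)
  have 0: "0 \<in> C"
    unfolding C_def by (rule range_eqI[of _ _ 0]) simp
  have "0 < x \<and> (\<forall>y<x. \<exists>z<x. y < z)"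
  proof (intro conjI allI impI)
    show "0 < x" using 0 x by auto
    fix y assume "y < x"
    then have "\<not> (\<forall>c\<in>C. c < y)"
      unfolding x_def by (rule not_less_Least)
    then obtain c where "c \<in> C" "y \<le> c" by (auto simp: not_less)
    then have "y < s c" "s c < x" using C x by (auto intro: le_less_trans)
    then show "\<exists>z<x. y < z" by blast
  qed
  then show ?thesis
    unfolding omega_def by (rule LeastI)
qed

lemma one_le_omega1: "0 < a \<Longrightarrow> 1 \<le> (a :: omega1)"
  unfolding one_omega1_def by (rule Least_le)


section \<open>Bases\<close>

type_synonym 'x base = "omega1 \<Rightarrow> 'x set set"

text \<open>The conditions \<open>{} \<in> L a\<close> and \<open>X \<in> L a\<close> are the empty union and the empty
  intersection.\<close>

definition is_base :: "'x set \<Rightarrow> 'x base \<Rightarrow> bool" where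
  "is_base X L \<longleftrightarrow>
     (\<forall>a. L a \<subseteq> Pow X \<and> {} \<in> L a \<and> X \<in> L a
        \<and> (\<forall>S :: nat \<Rightarrow> 'x set. range S \<subseteq> L a \<longrightarrow> \<Union> (range S) \<in> L a)
        \<and> (\<forall>S\<in>L a. \<forall>S'\<in>L a. S \<inter> S' \<in> L a))
   \<and> (\<forall>a b. a < b \<longrightarrow> (\<forall>S\<in>L a. S \<in> L b \<and> X - S \<in> L b))"

definition shift :: "omega1 \<Rightarrow> 'x base \<Rightarrow> 'x base" where
  "shift b L = (\<lambda>a. L (oadd b a))"

definition restrict_base :: "'x set \<Rightarrow> 'x base \<Rightarrow> 'x base" where
  "restrict_base U L = (\<lambda>a. (\<lambda>S. U \<inter> S) ` L a)"

text \<open>\<open>Sigma0 a S\<close> says that \<open>S\<close> is a $\mathbf{\Sigma}^0_a$ set; this is meant for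
  $a \ge 1$ and is false for $a = 0$.\<close>

inductive Sigma0 :: "omega1 \<Rightarrow> 'x::topological_space set \<Rightarrow> bool" where
  "open S \<Longrightarrow> Sigma0 1 S"
| "1 < a \<Longrightarrow> (\<And>n :: nat. 1 \<le> b n) \<Longrightarrow> (\<And>n. b n < a) \<Longrightarrow> (\<And>n. Sigma0 (b n) (S n)) \<Longrightarrow>
     Sigma0 a (\<Union>n. - S n)"

definition borel_base :: "'x::topological_space base" where
  "borel_base = (\<lambda>a. {S. Sigma0 (oadd 1 a) S})"


text \<open>The type class topology on \<^typ>\<open>nat \<Rightarrow> nat\<close> is the product of the discrete topologies.\<close>

type_synonym baire = "nat \<Rightarrow> nat"

lemma Sigma0_ge_1: "Sigma0 a S \<Longrightarrow> 1 \<le> a"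
  by (induction rule: Sigma0.cases) auto

lemma open_imp_Union_closed:
  fixes S :: "baire set"
  assumes "open S"
  shows "\<exists>C :: nat \<Rightarrow> baire set. (\<forall>n. open (C n)) \<and> S = (\<Union>n. - C n)"
proof -
  define cyl where "cyl s = {x :: nat \<Rightarrow> nat. \<forall>i\<in>{..<length s}. x i = s ! i}" for s
  have "closed {x :: nat \<Rightarrow> nat. x i = k}" for i k
    by (intro closed_Collect_eq continuous_on_const continuous_on_product_coordinates)
  then have closed_cyl: "closed (cyl s)" for s
  proof -
    have "cyl s = (\<Inter>i\<in>{..<length s}. {x. x i = s ! i})"
      by (auto simp: cyl_def)
    then show ?thesis
      using \<open>\<And>i k. closed {x :: nat \<Rightarrow> nat. x i = k}\<close> by (auto intro: closed_INT)
  qed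
  have cyl_nbhd: "\<exists>s. x \<in> cyl s \<and> cyl s \<subseteq> S" if x: "x \<in> S" for x
  proof -
    obtain X where X: "x \<in> (\<Pi>\<^sub>E i\<in>UNIV. X i)" "finite {i. X i \<noteq> (UNIV :: nat set)}"
        "(\<Pi>\<^sub>E i\<in>UNIV. X i) \<subseteq> S"
      using product_topology_open_contains_basis[of "\<lambda>_. euclidean" UNIV S x] assms x
      unfolding open_fun_def by auto
    obtain n where n: "\<And>i. X i \<noteq> UNIV \<Longrightarrow> i < n"
      using X(2) unfolding finite_nat_set_iff_bounded by auto
    have "cyl (map x [0..<n]) \<subseteq> (\<Pi>\<^sub>E i\<in>UNIV. X i)"
    proof
      fix y assume y: "y \<in> cyl (map x [0..<n])"
      have "y i \<in> X i" for i
      proof (cases "X i = UNIV")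
        case False
        then have "y i = x i" using n[of i] y by (auto simp: cyl_def)
        then show ?thesis using X(1) by (auto simp: PiE_iff)
      qed simp
      then show "y \<in> (\<Pi>\<^sub>E i\<in>UNIV. X i)" by auto
    qed
    moreover have "x \<in> cyl (map x [0..<n])" by (simp add: cyl_def)
    ultimately show ?thesis using X(3) by blast
  qed
  define C where "C n = (if cyl (from_nat n) \<subseteq> S then - cyl (from_nat n) else UNIV)" for n :: nat
  have "open (C n)" for n
    using closed_cyl by (simp add: C_def open_Compl)
  moreover have "S = (\<Union>n. - C n)"
  proof
    show "S \<subseteq> (\<Union>n. - C n)"
    proof
      fix x assume "x \<in> S"
      then obtain s where "x \<in> cyl s" "cyl s \<subseteq> S" using cyl_nbhd by blast
      then have "x \<in> - C (to_nat s)" by (simp add: C_def)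
      then show "x \<in> (\<Union>n. - C n)" by blast
    qed
    show "(\<Union>n. - C n) \<subseteq> S" by (auto simp: C_def split: if_splits)
  qed
  ultimately show ?thesis by blast
qed

lemma Sigma0_mono:
  fixes S :: "baire set"
  assumes "Sigma0 a S" "a \<le> b"
  shows "Sigma0 b S"
  using assms
proof (cases rule: Sigma0.cases)
  case 1
  show ?thesis
  proof (cases "b = 1")
    case True
    then show ?thesis using 1 by (auto intro: Sigma0.intros)
  next
    case False
    then have "1 < b" using assms 1 by auto
    obtain C :: "nat \<Rightarrow> baire set" where "\<And>n. open (C n)" "S = (\<Union>n. - C n)"
      using open_imp_Union_closed[of S] 1 by auto
    then show ?thesis
      using Sigma0.intros(2)[of b "\<lambda>_. 1" C] \<open>1 < b\<close> by (auto intro: Sigma0.intros(1))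
  qed
next
  case (2 c T)
  then show ?thesis
    using assms by (auto intro!: Sigma0.intros(2)[of b c T] intro: less_le_trans)
qed

lemma Sigma0_Compl:
  "Sigma0 a S \<Longrightarrow> a < b \<Longrightarrow> Sigma0 b (- S)"
  using Sigma0.intros(2)[of b "\<lambda>_. a" "\<lambda>_. S"] Sigma0_ge_1[of a S] by auto

lemma Sigma0_D:
  assumes "Sigma0 a S" "a \<noteq> 1"
  shows "\<exists>c T. (\<forall>m::nat. 1 \<le> c m \<and> c m < a \<and> Sigma0 (c m) (T m)) \<and> S = (\<Union>m. - T m)"
  using assms(1)
proof (cases rule: Sigma0.cases)
  case 1
  then show ?thesis using assms(2) by simp
next
  case (2 c T)
  then show ?thesis by (intro exI[of _ c] exI[of _ T]) simp
qed

lemma Sigma0_Union: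
  fixes S :: "nat \<Rightarrow> baire set"
  assumes "\<And>n. Sigma0 a (S n)"
  shows "Sigma0 a (\<Union>n. S n)"
proof (cases "a = 1")
  case True
  then have "open (S n)" for n
    using assms[of n] by (auto elim: Sigma0.cases)
  then show ?thesis using True by (auto intro: Sigma0.intros(1))
next
  case False
  have "\<exists>c T. (\<forall>m::nat. 1 \<le> c m \<and> c m < a \<and> Sigma0 (c m) (T m)) \<and> S n = (\<Union>m. - T m)" for n
    by (rule Sigma0_D[OF assms[of n] False])
  then obtain c T where *: "\<And>n m::nat. 1 \<le> c n m \<and> c n m < a \<and> Sigma0 (c n m) (T n m)"
      "\<And>n. S n = (\<Union>m. - T n m)"
    by metis
  have "1 < a" using Sigma0_ge_1[OF assms] False by auto
  moreover have "(\<Union>n. S n) = (\<Union>k. - (\<lambda>k. T (fst (prod_decode k)) (snd (prod_decode k))) k)"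
    unfolding *(2) by (auto; metis fst_conv prod_encode_inverse snd_conv)
  ultimately show ?thesis
    using * Sigma0.intros(2)[of a "\<lambda>k. c (fst (prod_decode k)) (snd (prod_decode k))"
        "\<lambda>k. T (fst (prod_decode k)) (snd (prod_decode k))"] by auto
qed

lemma Sigma0_Un:
  fixes S :: "baire set"
  assumes "Sigma0 a S" "Sigma0 a S'"
  shows "Sigma0 a (S \<union> S')"
proof -
  have "S \<union> S' = (\<Union>n::nat. if n = 0 then S else S')"
    by (auto split: if_splits)
  then show ?thesis
    using Sigma0_Union[of a "\<lambda>n. if n = 0 then S else S'"] assms by auto
qed

lemma Sigma0_Int:
  fixes S :: "baire set"
  assumes "Sigma0 a S" "Sigma0 a S'"
  shows "Sigma0 a (S \<inter> S')"
proof (cases "a = 1")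
  case True
  then have "open S" "open S'"
    using assms by (auto elim: Sigma0.cases)
  then show ?thesis using True by (auto intro: Sigma0.intros(1))
next
  case False
  have "\<exists>c T. (\<forall>m::nat. 1 \<le> c m \<and> c m < a \<and> Sigma0 (c m) (T m)) \<and> S = (\<Union>m. - T m)"
    by (rule Sigma0_D[OF assms(1) False])
  then obtain c T where *: "\<And>m::nat. 1 \<le> c m \<and> c m < a \<and> Sigma0 (c m) (T m)" "S = (\<Union>m. - T m)"
    by metis
  have "\<exists>c T. (\<forall>m::nat. 1 \<le> c m \<and> c m < a \<and> Sigma0 (c m) (T m)) \<and> S' = (\<Union>m. - T m)"
    by (rule Sigma0_D[OF assms(2) False])
  then obtain c' T' where **: "\<And>m::nat. 1 \<le> c' m \<and> c' m < a \<and> Sigma0 (c' m) (T' m)" "S' = (\<Union>m. - T' m)"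
    by metis
  have "Sigma0 a (- (T m \<union> T' n))" for m n
  proof -
    let ?d = "max (c m) (c' n)"
    have "Sigma0 ?d (T m)" "Sigma0 ?d (T' n)"
      using *(1)[of m] **(1)[of n] by (auto intro: Sigma0_mono)
    then have "Sigma0 ?d (T m \<union> T' n)" by (rule Sigma0_Un)
    then show ?thesis by (rule Sigma0_Compl) (use *(1)[of m] **(1)[of n] in auto)
  qed
  then have "Sigma0 a (\<Union>m. \<Union>n. - (T m \<union> T' n))"
    by (intro Sigma0_Union)
  also have "(\<Union>m. \<Union>n. - (T m \<union> T' n)) = S \<inter> S'"
    unfolding *(2) **(2) by auto
  finally show ?thesis .
qed

lemma is_base_borel_base: "is_base UNIV (borel_base :: baire base)"
proof -
  have "Sigma0 1 ({} :: baire set)" "Sigma0 1 (UNIV :: baire set)"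
    by (auto intro: Sigma0.intros(1))
  then have "Sigma0 (oadd 1 a) ({} :: baire set)" "Sigma0 (oadd 1 a) (UNIV :: baire set)" for a
    using Sigma0_mono oadd_bounds(1) by blast+
  moreover have "Sigma0 (oadd 1 b) S \<and> Sigma0 (oadd 1 b) (- S)"
    if "a < b" "Sigma0 (oadd 1 a) S" for a b and S :: "baire set"
    using that oadd_bounds(2)[of a b 1] Sigma0_mono Sigma0_Compl less_imp_le by blast
  moreover have "Sigma0 (oadd 1 a) (\<Union> (range S))" if "range S \<subseteq> {S. Sigma0 (oadd 1 a) S}"
    for a and S :: "nat \<Rightarrow> baire set"
    using that Sigma0_Union[of "oadd 1 a" S] by auto
  ultimately show ?thesis
    unfolding is_base_def borel_base_def by (auto simp: Compl_eq_Diff_UNIV[symmetric] Sigma0_Int)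
qed

lemma is_base_shift: "is_base X L \<Longrightarrow> is_base X (shift b L)"
  unfolding is_base_def shift_def using oadd_bounds(2) by meson

lemma is_base_restrict_base:
  assumes "is_base X L" "U \<subseteq> X"
  shows "is_base U (restrict_base U L)"
proof -
  have A: "\<Union> (range S) \<in> restrict_base U L a" if "range S \<subseteq> restrict_base U L a"
    for a and S :: "nat \<Rightarrow> 'a set"
  proof -
    have "\<forall>n. \<exists>V\<in>L a. S n = U \<inter> V"
    proof
      fix n
      have "S n \<in> restrict_base U L a" using that by auto
      then show "\<exists>V\<in>L a. S n = U \<inter> V" unfolding restrict_base_def by blast
    qed
    then obtain V where V: "\<And>n. V n \<in> L a" "\<And>n. S n = U \<inter> V n" by metis
    then have "\<Union> (range V) \<in> L a" using assms(1) unfolding is_base_def by (meson image_subsetI)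
    moreover have "\<Union> (range S) = U \<inter> \<Union> (range V)" using V by auto
    ultimately show ?thesis by (auto simp: restrict_base_def)
  qed
  have B: "S \<inter> S' \<in> restrict_base U L a" if S: "S \<in> restrict_base U L a" "S' \<in> restrict_base U L a"
    for a S S'
  proof -
    obtain V V' where V: "V \<in> L a" "V' \<in> L a" "S = U \<inter> V" "S' = U \<inter> V'"
      using S by (auto simp: restrict_base_def)
    then have "V \<inter> V' \<in> L a" using assms(1) unfolding is_base_def by blast
    moreover have "S \<inter> S' = U \<inter> (V \<inter> V')" using V by auto
    ultimately show ?thesis by (auto simp: restrict_base_def)
  qed
  have C: "S \<in> restrict_base U L b \<and> U - S \<in> restrict_base U L b"
    if S: "a < b" "S \<in> restrict_base U L a" for a b S
  proof -
    obtain V where V: "V \<in> L a" "S = U \<inter> V" using S by (auto simp: restrict_base_def)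
    have "\<forall>a b. a < b \<longrightarrow> (\<forall>S\<in>L a. S \<in> L b \<and> X - S \<in> L b)"
      using assms(1) unfolding is_base_def by (rule conjunct2)
    with V S(1) have "V \<in> L b" "X - V \<in> L b" by simp_all
    moreover have "U - S = U \<inter> (X - V)" using V assms(2) by auto
    ultimately show ?thesis using V by (auto simp: restrict_base_def)
  qed
  have D: "{} \<in> restrict_base U L a" "U \<in> restrict_base U L a" "restrict_base U L a \<subseteq> Pow U" for a
  proof -
    have "{} \<in> L a" "X \<in> L a" using assms(1) unfolding is_base_def by blast+
    moreover have "{} = U \<inter> {}" "U = U \<inter> X" using assms(2) by auto
    ultimately show "{} \<in> restrict_base U L a" "U \<in> restrict_base U L a" unfolding restrict_base_def by blast+
    show "restrict_base U L a \<subseteq> Pow U" unfolding restrict_base_def by blast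
  qed
  show ?thesis
    unfolding is_base_def by (intro conjI allI impI ballI) (use A B C D in auto)
qed


section \<open>Terms and their labeled trees\<close>

datatype 'q trm =
    Const 'q
  | Sh omega1 "'q trm"
  | FQ 'q "nat \<Rightarrow> 'q trm"
  | FO omega1 "nat \<Rightarrow> 'q trm"

primrec tree :: "'q trm \<Rightarrow> nat list set" where
  "tree (Const q) = {[]}"
| "tree (Sh a u) = {[]}"
| "tree (FQ q us) = insert [] (\<Union>i. (#) i ` tree (us i))"
| "tree (FO a us) = insert [] (\<Union>i. (#) i ` tree (us (Suc i)))"

text \<open>Only the values of \<open>label u\<close> on \<open>tree u\<close> matter.\<close>

primrec label :: "'q trm \<Rightarrow> nat list \<Rightarrow> 'q trm" where
  "label (Const q) = (\<lambda>t. Const q)"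
| "label (Sh a u) = (\<lambda>t. Sh a u)"
| "label (FQ q us) = (\<lambda>t. case t of [] \<Rightarrow> Const q | i # t' \<Rightarrow> label (us i) t')"
| "label (FO a us) = (\<lambda>t. case t of [] \<Rightarrow> Sh a (us 0) | i # t' \<Rightarrow> label (us (Suc i)) t')"


section \<open>Families\<close>

definition monotone_family :: "nat list set \<Rightarrow> (nat list \<Rightarrow> 'x set) \<Rightarrow> bool" where
  "monotone_family T U \<longleftrightarrow> (\<forall>t\<in>T. \<forall>t'\<in>T. prefix t t' \<longrightarrow> U t' \<subseteq> U t)"

definition component :: "nat list set \<Rightarrow> (nat list \<Rightarrow> 'x set) \<Rightarrow> nat list \<Rightarrow> 'x set" where
  "component T U t = U t - \<Union> {U t' | t'. t' \<in> T \<and> strict_prefix t t'}"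

text \<open>Families indexed by a tree are represented by functions on all strings, whose values
  outside the tree are irrelevant.\<close>

datatype 'x fam =
    Single "'x set"
  | Nested "nat list \<Rightarrow> 'x set" "nat list \<Rightarrow> 'x fam"

text \<open>\<open>is_family L X u F\<close>: \<open>F\<close> is a \<open>u\<close>-family in the base \<open>L\<close> in \<open>X\<close>. An inductive definition
  is used because in the last rule \<open>label u t\<close> need not be a subterm of \<open>u\<close>.\<close>

inductive is_family :: "'x base \<Rightarrow> 'x set \<Rightarrow> 'q trm \<Rightarrow> 'x fam \<Rightarrow> bool" where
  "is_family L X (Const q) (Single X)"
| "is_family (shift (omega_pow a) L) X u F \<Longrightarrow> is_family L X (Sh a u) F"
| "u = FQ q us \<or> u = FO a us \<Longrightarrow>
   monotone_family (tree u) U \<Longrightarrow>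
   (\<And>t. t \<in> tree u \<Longrightarrow> U t \<in> L 0) \<Longrightarrow>
   U [] = X \<Longrightarrow>
   (\<And>t. t \<in> tree u \<Longrightarrow>
      is_family (restrict_base (component (tree u) U t) L) (component (tree u) U t)
        (label u t) (F t)) \<Longrightarrow>
   is_family L X u (Nested U F)"

text \<open>\<open>determines L X u F A\<close>: the \<open>u\<close>-family \<open>F\<close> in \<open>L\<close> determines the restriction of \<open>A\<close>
  to \<open>X\<close>.\<close>

inductive determines ::
    "'x base \<Rightarrow> 'x set \<Rightarrow> 'q trm \<Rightarrow> 'x fam \<Rightarrow> ('x \<Rightarrow> 'q) \<Rightarrow> bool" where
  "(\<And>x. x \<in> X \<Longrightarrow> A x = q) \<Longrightarrow> determines L X (Const q) (Single X) A"
| "determines (shift (omega_pow a) L) X u F A \<Longrightarrow> determines L X (Sh a u) F A"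
| "u = FQ q us \<or> u = FO a us \<Longrightarrow>
   (\<And>t. t \<in> tree u \<Longrightarrow>
      determines (restrict_base (component (tree u) U t) L) (component (tree u) U t)
        (label u t) (F t) A) \<Longrightarrow>
   determines L X u (Nested U F) A"

text \<open>The level $\mathcal{L}(X,u)$ for $X$ the whole type.\<close>

definition level :: "'x base \<Rightarrow> 'q trm \<Rightarrow> ('x \<Rightarrow> 'q) set" where
  "level L u = {A. \<exists>F. is_family L UNIV u F \<and> determines L UNIV u F A}"


section \<open>Wadge reducibility\<close>

definition wadge_le :: "('q \<Rightarrow> 'q \<Rightarrow> bool) \<Rightarrow> (baire \<Rightarrow> 'q) \<Rightarrow> (baire \<Rightarrow> 'q) \<Rightarrow> bool" where
  "wadge_le le A B \<longleftrightarrow> (\<exists>f. continuous_on UNIV f \<and> (\<forall>x. le (A x) (B (f x))))"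

end

theory Submission
  imports Defs
begin

text \<open>
  The complete function is a universal one. For every term \<open>u\<close> there is a function \<open>E\<close> in the level
  of \<open>u\<close> such that every function \<open>A\<close> of that level is a section \<open>x \<mapsto> E \<langle>c, x\<rangle>\<close> of \<open>E\<close> for some code
  \<open>c\<close>; the continuous map \<open>x \<mapsto> \<langle>c, x\<rangle>\<close> then reduces \<open>A\<close> to \<open>E\<close>.

  The existence of \<open>E\<close> is proved by induction on \<open>u\<close> (\<open>trm_label_induct\<close>), in a form strong enough
  for the induction (\<open>exists_universal\<close>): the levels of the base may be
  $\mathbf{\Sigma}^0_{g(\alpha)}$ for any function $g \ge 1$, which covers all the shifts, and the
  sections of \<open>E\<close> must exhaust even the functions determined by a family on an arbitrary subset of
  the space, which covers all the restrictions to components.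

  In the inductive step a code lists, for every node \<open>t\<close> of the tree of \<open>u\<close>, a code of a set with
  respect to a universal $\mathbf{\Sigma}^0_{g(0)}$ set (\<open>Sigma0_universal\<close>) and a code of a function
  with respect to the universal function of the label of \<open>t\<close>. An arbitrary code need not describe a
  family that determines a function, since the components of a family may overlap. The reduction
  property of $\mathbf{\Sigma}^0_a$ (\<open>Sigma0_reduction\<close>), applied successively along the tree
  (\<open>Sigma0_tree_reduction\<close>), replaces the coded sets uniformly by a monotone family with
  pairwise disjoint components; if the coded sets already form a monotone family, then each new
  component is contained in the old one at the same node. Hence every code yields
  a function, and a code of a family that determines \<open>A\<close> yields \<open>A\<close>. Finally, families can be pulled
  back along continuous maps (\<open>represents_pullback\<close>), so the universal functions of the labels can be
  glued to a function that is again in the level of \<open>u\<close>.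
\<close>

section \<open>Terms and trees\<close>

text \<open>A label of a node of \<open>tree u\<close> is either a constant or a term \<open>Sh a v\<close> with \<open>v\<close> a proper subterm
  of \<open>u\<close>; hence this induction is justified although labels need not be subterms.\<close>

lemma trm_label_induct [case_names Const Sh Node]:
  assumes Const: "\<And>q. P (Const q)"
    and Sh: "\<And>a u. P u \<Longrightarrow> P (Sh a u)"
    and Node: "\<And>u q a us. u = FQ q us \<or> u = FO a us \<Longrightarrow> (\<And>t. t \<in> tree u \<Longrightarrow> P (label u t)) \<Longrightarrow> P u"
  shows "P u"
proof -
  have "P u \<and> (\<forall>t\<in>tree u. P (label u t))"
  proof (induction u)
    case (Const q)
    then show ?case using assms(1) by simp
  next
    case (Sh a u)
    then show ?case using assms(2) by simp
  next
    case (FQ q us)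
    have "\<forall>t\<in>tree (FQ q us). P (label (FQ q us) t)"
      using FQ assms(1) by auto
    then show ?case using Node[of "FQ q us" q us] by blast
  next
    case (FO a us)
    have "\<forall>t\<in>tree (FO a us). P (label (FO a us) t)"
      using FO assms(2) by auto
    then show ?case using Node[of "FO a us" _ us a] by blast
  qed
  then show ?thesis by blast
qed

lemma tree_prefix_closed: "t @ s \<in> tree u \<Longrightarrow> t \<in> tree u"
proof (induction u arbitrary: t)
  case (FQ q us)
  show ?case
  proof (cases t)
    case (Cons i t')
    with FQ.prems have "t' @ s \<in> tree (us i)" by auto
    with FQ.IH[of "us i" t'] Cons show ?thesis by auto
  qed simp
next
  case (FO a us)
  show ?case
  proof (cases t)
    case (Cons i t')
    with FO.prems have "t' @ s \<in> tree (us (Suc i))" by auto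
    with FO.IH[of "us (Suc i)" t'] Cons show ?thesis by auto
  qed simp
qed auto

text \<open>Well-foundedness of \<open>tree u\<close>, in the form that makes the components of a family cover the
  space: a path through nodes satisfying \<open>P\<close> stops.\<close>

lemma tree_maximal_node:
  assumes "P []"
  shows "\<exists>t\<in>tree u. P t \<and> (\<forall>i. t @ [i] \<in> tree u \<longrightarrow> \<not> P (t @ [i]))"
  using assms
proof (induction u arbitrary: P)
  case (FQ q us)
  show ?case
  proof (cases "\<exists>i. P [i]")
    case True
    then obtain i where "P [i]" ..
    then obtain t where "t \<in> tree (us i)" "P (i # t)" "\<forall>j. t @ [j] \<in> tree (us i) \<longrightarrow> \<not> P (i # t @ [j])"
      using FQ.IH[of "us i" "\<lambda>t. P (i # t)"] by auto
    then show ?thesis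
      by (intro bexI[of _ "i # t"]) auto
  next
    case False
    with FQ.prems show ?thesis by (intro bexI[of _ "[]"]) auto
  qed
next
  case (FO a us)
  show ?case
  proof (cases "\<exists>i. P [i]")
    case True
    then obtain i where "P [i]" ..
    then obtain t where "t \<in> tree (us (Suc i))" "P (i # t)" "\<forall>j. t @ [j] \<in> tree (us (Suc i)) \<longrightarrow> \<not> P (i # t @ [j])"
      using FO.IH[of "us (Suc i)" "\<lambda>t. P (i # t)"] by auto
    then show ?thesis
      by (intro bexI[of _ "i # t"]) auto
  next
    case False
    with FO.prems show ?thesis by (intro bexI[of _ "[]"]) auto
  qed
qed auto


section \<open>Functions determined by a family\<close>

definition represents :: "'x base \<Rightarrow> 'x set \<Rightarrow> 'q trm \<Rightarrow> ('x \<Rightarrow> 'q) \<Rightarrow> bool" where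
  "represents L X u A \<longleftrightarrow> (\<exists>F. is_family L X u F \<and> determines L X u F A)"

lemma represents_Const: "represents L X (Const q) A \<longleftrightarrow> (\<forall>x\<in>X. A x = q)"
proof
  assume "represents L X (Const q) A"
  then show "\<forall>x\<in>X. A x = q"
    unfolding represents_def by (auto elim: is_family.cases determines.cases)
qed (auto simp: represents_def intro: is_family.intros(1) determines.intros(1))

lemma represents_Sh: "represents L X (Sh a u) A \<longleftrightarrow> represents (shift (omega_pow a) L) X u A"
proof
  assume "represents L X (Sh a u) A"
  then obtain F where F: "is_family L X (Sh a u) F" "determines L X (Sh a u) F A"
    by (auto simp: represents_def)
  from F(1) have "is_family (shift (omega_pow a) L) X u F"
    by (cases rule: is_family.cases) auto
  moreover from F(2) have "determines (shift (omega_pow a) L) X u F A"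
    by (cases rule: determines.cases) auto
  ultimately show "represents (shift (omega_pow a) L) X u A"
    by (auto simp: represents_def)
qed (auto simp: represents_def intro: is_family.intros(2) determines.intros(2))

lemma represents_NodeI:
  assumes u: "u = FQ q us \<or> u = FO a us"
    and U: "monotone_family (tree u) U" "\<And>t. t \<in> tree u \<Longrightarrow> U t \<in> L 0" "U [] = X"
    and rep: "\<And>t. t \<in> tree u \<Longrightarrow>
      represents (restrict_base (component (tree u) U t) L) (component (tree u) U t) (label u t) A"
  shows "represents L X u A"
proof -
  from rep obtain F where F: "\<And>t. t \<in> tree u \<Longrightarrow>
      is_family (restrict_base (component (tree u) U t) L) (component (tree u) U t) (label u t) (F t)"
    "\<And>t. t \<in> tree u \<Longrightarrow>
      determines (restrict_base (component (tree u) U t) L) (component (tree u) U t) (label u t) (F t) A"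
    unfolding represents_def by metis
  have "is_family L X u (Nested U F)"
    using u U F(1) by (rule is_family.intros(3))
  moreover have "determines L X u (Nested U F) A"
    using u F(2) by (rule determines.intros(3))
  ultimately show ?thesis by (auto simp: represents_def)
qed

lemma represents_NodeE:
  assumes u: "u = FQ q us \<or> u = FO a us" and rep: "represents L X u A"
  obtains U where "monotone_family (tree u) U" "\<And>t. t \<in> tree u \<Longrightarrow> U t \<in> L 0" "U [] = X"
    "\<And>t. t \<in> tree u \<Longrightarrow>
      represents (restrict_base (component (tree u) U t) L) (component (tree u) U t) (label u t) A"
proof -
  from rep obtain F where F: "is_family L X u F" "determines L X u F A"
    by (auto simp: represents_def)
  from F(1) show thesis
  proof (cases rule: is_family.cases)
    case (3 q' us' a' U F')
    from F(2) 3(1) have "\<And>t. t \<in> tree u \<Longrightarrow>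
        determines (restrict_base (component (tree u) U t) L) (component (tree u) U t) (label u t) (F' t) A"
      using u by (cases rule: determines.cases) auto
    with 3 show thesis
      by (intro that[of U]) (auto simp: represents_def)
  qed (use u in auto)
qed

text \<open>Taking preimages commutes with forming components, so a family can be pulled back node by
  node. For a map that is the identity this is restriction to a subset.\<close>

lemma represents_pullback:
  assumes "represents L X u A"
    and "\<And>y. y \<in> Y \<Longrightarrow> f y \<in> X"
    and "\<And>a S. S \<in> L a \<Longrightarrow> Y \<inter> f -` S \<in> L' a"
    and "\<And>y. y \<in> Y \<Longrightarrow> A' y = A (f y)"
  shows "represents L' Y u A'"
  using assms
proof (induction u arbitrary: L X L' Y rule: trm_label_induct)
  case (Const q)
  then show ?case by (auto simp: represents_Const)
next
  case (Sh a u)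
  show ?case
    unfolding represents_Sh
    by (rule Sh.IH[OF Sh.prems(1)[unfolded represents_Sh]]) (use Sh.prems in \<open>auto simp: shift_def\<close>)
next
  case (Node u q a us)
  from represents_NodeE[OF Node.hyps Node.prems(1)]
  obtain U where U: "monotone_family (tree u) U" "\<And>t. t \<in> tree u \<Longrightarrow> U t \<in> L 0" "U [] = X"
    "\<And>t. t \<in> tree u \<Longrightarrow>
      represents (restrict_base (component (tree u) U t) L) (component (tree u) U t) (label u t) A"
    by blast
  define V where "V t = Y \<inter> f -` U t" for t
  have comp: "component (tree u) V t = Y \<inter> f -` component (tree u) U t" for t
    by (auto simp: component_def V_def)
  show ?case
  proof (rule represents_NodeI[OF Node.hyps, of V])
    show "monotone_family (tree u) V"
      using U(1) unfolding monotone_family_def V_def by blast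
    show "V t \<in> L' 0" if "t \<in> tree u" for t
      using U(2)[OF that] Node.prems(3) by (simp add: V_def)
    show "V [] = Y"
      using U(3) Node.prems(2) by (auto simp: V_def)
    fix t assume t: "t \<in> tree u"
    show "represents (restrict_base (component (tree u) V t) L') (component (tree u) V t) (label u t) A'"
    proof (rule Node.IH[OF t U(4)[OF t]])
      fix b S assume "S \<in> restrict_base (component (tree u) U t) L b"
      then obtain S' where S': "S' \<in> L b" "S = component (tree u) U t \<inter> S'"
        by (auto simp: restrict_base_def)
      have "component (tree u) V t \<inter> f -` S = component (tree u) V t \<inter> (Y \<inter> f -` S')"
        unfolding comp S'(2) by auto
      then show "component (tree u) V t \<inter> f -` S \<in> restrict_base (component (tree u) V t) L' b"
        using Node.prems(3)[OF S'(1)] by (auto simp: restrict_base_def)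
    qed (use Node.prems(4) comp in auto)
  qed
qed

lemma restrict_base_restrict_base:
  "C \<subseteq> U \<Longrightarrow> restrict_base C (restrict_base U L) = restrict_base C L"
proof -
  assume "C \<subseteq> U"
  then have "C \<inter> (U \<inter> S) = C \<inter> S" for S by auto
  then show ?thesis by (simp add: restrict_base_def image_image)
qed


section \<open>Coding in the Baire space\<close>

definition pair :: "baire \<Rightarrow> baire \<Rightarrow> baire" where
  "pair c x = (\<lambda>n. if even n then c (n div 2) else x (n div 2))"

definition left :: "baire \<Rightarrow> baire" where
  "left z = (\<lambda>n. z (2 * n))"

definition right :: "baire \<Rightarrow> baire" where
  "right z = (\<lambda>n. z (2 * n + 1))"

lemma left_pair [simp]: "left (pair c x) = c"
  by (simp add: left_def pair_def)

lemma right_pair [simp]: "right (pair c x) = x"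
  by (simp add: right_def pair_def)

definition slot :: "'i::countable \<Rightarrow> baire \<Rightarrow> baire" where
  "slot i c = (\<lambda>n. c (prod_encode (to_nat i, n)))"

lemma exists_slots:
  fixes d :: "'i::countable \<Rightarrow> baire"
  obtains c where "\<And>i. slot i c = d i"
proof
  fix i :: 'i
  show "slot i (\<lambda>k. d (from_nat (fst (prod_decode k))) (snd (prod_decode k))) = d i"
    by (simp add: slot_def)
qed

lemma continuous_on_coordinate:
  fixes f :: "'a::topological_space \<Rightarrow> baire"
  shows "continuous_on S f \<Longrightarrow> continuous_on S (\<lambda>x. f x n)"
  by (rule continuous_on_product_then_coordinatewise)

lemma continuous_on_pair:
  assumes "continuous_on S f" "continuous_on S g"
  shows "continuous_on S (\<lambda>x. pair (f x) (g x))"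
proof (rule continuous_on_coordinatewise_then_product)
  fix n
  show "continuous_on S (\<lambda>x. pair (f x) (g x) n)"
    using assms by (cases "even n") (auto simp: pair_def intro: continuous_on_coordinate)
qed

lemma continuous_on_left: "continuous_on S left"
  unfolding left_def
  by (rule continuous_on_coordinatewise_then_product) (intro continuous_on_coordinate continuous_on_id)

lemma continuous_on_right: "continuous_on S right"
  unfolding right_def
  by (rule continuous_on_coordinatewise_then_product) (intro continuous_on_coordinate continuous_on_id)

lemma continuous_on_slot: "continuous_on S (slot i)"
  unfolding slot_def
  by (rule continuous_on_coordinatewise_then_product) (intro continuous_on_coordinate continuous_on_id)

lemma continuous_on_pair_slot: "continuous_on UNIV (\<lambda>z. pair (slot i (left z)) (right z))"
  by (intro continuous_on_pair continuous_on_right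
      continuous_on_compose2[OF continuous_on_slot[of UNIV] continuous_on_left]) auto

text \<open>The cylinders, and the empty set with index \<open>0\<close>; the latter makes it possible to write every
  open set, even the empty one, as the union of a sequence of basic sets.\<close>

definition basic :: "nat \<Rightarrow> baire set" where
  "basic m = (case m of 0 \<Rightarrow> {} | Suc k \<Rightarrow> {x. \<forall>i<length (from_nat k :: nat list). x i = from_nat k ! i})"

lemma open_coordinate: "open {x :: baire. x i = k}"
proof -
  have "{x :: baire. x i = k} = (\<lambda>x. x i) -` {k}" by auto
  then show ?thesis
    using open_vimage[of "{k}" "\<lambda>x :: baire. x i"] by (simp add: open_discrete)
qed

lemma closed_coordinate: "closed {x :: baire. x i = k}"
proof -
  have "{x :: baire. x i = k} = (\<lambda>x. x i) -` {k}" by auto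
  then show ?thesis
    using closed_vimage[of "{k}" "\<lambda>x :: baire. x i"] by simp
qed

lemma basic_Suc: "basic (Suc k) =
    (\<Inter>i\<in>{..<length (from_nat k :: nat list)}. {x. x i = from_nat k ! i})"
  by (auto simp: basic_def)

lemma open_basic: "open (basic m)"
proof (cases m)
  case (Suc k)
  show ?thesis unfolding Suc basic_Suc by (intro open_INT ballI open_coordinate) simp
qed (simp add: basic_def)

lemma closed_basic: "closed (basic m)"
proof (cases m)
  case (Suc k)
  show ?thesis unfolding Suc basic_Suc by (intro closed_INT ballI closed_coordinate)
qed (simp add: basic_def)

lemma open_contains_basic:
  assumes S: "open S" and x: "x \<in> S"
  shows "\<exists>m. x \<in> basic m \<and> basic m \<subseteq> S"
proof -
  obtain X where X: "x \<in> (\<Pi>\<^sub>E i\<in>UNIV. X i)" "finite {i. X i \<noteq> (UNIV :: nat set)}"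
      "(\<Pi>\<^sub>E i\<in>UNIV. X i) \<subseteq> S"
    using product_topology_open_contains_basis[of "\<lambda>_. euclidean" UNIV S x] S x
    unfolding open_fun_def by auto
  obtain n where n: "\<And>i. X i \<noteq> UNIV \<Longrightarrow> i < n"
    using X(2) unfolding finite_nat_set_iff_bounded by auto
  define m where "m = Suc (to_nat (map x [0..<n]))"
  have m: "basic m = {y. \<forall>i<n. y i = x i}"
    by (auto simp: m_def basic_def)
  have "y \<in> S" if "y \<in> basic m" for y
  proof -
    have "y i \<in> X i" for i
    proof (cases "X i = UNIV")
      case False
      then have "y i = x i" using n[of i] that by (auto simp: m)
      then show ?thesis using X(1) by (auto simp: PiE_iff)
    qed simp
    then show ?thesis using X(3) by auto
  qed
  then show ?thesis using m by auto
qed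

lemma open_eq_Union_basic:
  assumes "open S"
  obtains c :: "nat \<Rightarrow> nat" where "S = (\<Union>n. basic (c n))"
proof (rule that)
  show "S = (\<Union>n. basic (if basic n \<subseteq> S then n else 0))"
    using open_contains_basic[OF assms] by (fastforce simp: basic_def[of 0] split: if_splits)
qed


section \<open>Universal sets and reduction in the Borel hierarchy\<close>

lemma Sigma0_open: "1 \<le> a \<Longrightarrow> open S \<Longrightarrow> Sigma0 a (S :: baire set)"
  by (rule Sigma0_mono[of 1]) (auto intro: Sigma0.intros(1))

lemma Sigma0_vimage:
  fixes f :: "'a::topological_space \<Rightarrow> 'b::topological_space"
  assumes "Sigma0 a S" "continuous_on UNIV f"
  shows "Sigma0 a (f -` S)"
  using assms(1)
proof induction
  case (1 S)
  then show ?case using assms(2) by (auto intro!: Sigma0.intros(1) open_vimage)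
next
  case (2 a b S)
  have "f -` (\<Union>n. - S n) = (\<Union>n. - (f -` S n))" by auto
  then show ?case using Sigma0.intros(2)[of a b "\<lambda>n. f -` S n"] 2 by simp
qed

text \<open>For $a > 1$ a code of a $\mathbf{\Sigma}^0_a$ set lists countably many codes for each of the
  countably many lower classes; entries that are not needed code the whole space, whose complement
  contributes nothing to the union.\<close>

lemma Sigma0_universal:
  assumes "1 \<le> a"
  shows "\<exists>W. Sigma0 a W \<and> (\<forall>S. Sigma0 a S \<longrightarrow> (\<exists>c. \<forall>x. x \<in> S \<longleftrightarrow> pair c x \<in> W))"
  using assms
proof (induction a rule: less_induct)
  case (less a)
  show ?case
  proof (cases "a = 1")
    case True
    define W where "W = (\<Union>n k. {z. left z n = k} \<inter> right -` basic k)"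
    have "open {z. left z n = k}" for n k
      using open_coordinate by (simp add: left_def)
    then have "open W"
      unfolding W_def by (intro open_UN ballI open_Int open_vimage open_basic continuous_on_right)
    moreover have "\<exists>c. \<forall>x. x \<in> S \<longleftrightarrow> pair c x \<in> W" if "Sigma0 a S" for S
    proof -
      have "open S" using that True by (auto elim: Sigma0.cases)
      then obtain c :: "nat \<Rightarrow> nat" where "S = (\<Union>n. basic (c n))" by (rule open_eq_Union_basic)
      then show ?thesis by (intro exI[of _ c]) (auto simp: W_def)
    qed
    ultimately show ?thesis using True by (auto intro: Sigma0.intros(1))
  next
    case False
    then have a: "1 < a" using less.prems by simp
    define e where "e = from_nat_into {b. 1 \<le> b \<and> b < a}"
    have ne: "{b. 1 \<le> b \<and> b < a} \<noteq> {}" using a by auto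
    have ct: "countable {b. 1 \<le> b \<and> b < a}"
      by (rule countable_subset[OF _ countable_lessThan_omega1[of a]]) auto
    have e: "1 \<le> e k" "e k < a" for k
      using from_nat_into[OF ne, of k] by (auto simp: e_def)
    have e_surj: "\<exists>k. e k = b" if "1 \<le> b" "b < a" for b
      using from_nat_into_surj[OF ct, of b] that by (auto simp: e_def)
    have "\<forall>k. \<exists>W. Sigma0 (e k) W \<and> (\<forall>S. Sigma0 (e k) S \<longrightarrow> (\<exists>c. \<forall>x. x \<in> S \<longleftrightarrow> pair c x \<in> W))"
      using less.IH e by blast
    then obtain W where W: "\<And>k. Sigma0 (e k) (W k)"
      "\<And>k S. Sigma0 (e k) S \<Longrightarrow> \<exists>c. \<forall>x. x \<in> S \<longleftrightarrow> pair c x \<in> W k"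
      by metis
    define W' where "W' m = (\<lambda>z. pair (slot m (left z)) (right z)) -` W (snd (prod_decode m))" for m
    have "Sigma0 a (\<Union>m. - W' m)"
      by (rule Sigma0.intros(2)[OF a, of "\<lambda>m. e (snd (prod_decode m))"])
        (auto simp: W'_def e intro!: Sigma0_vimage W continuous_on_pair_slot)
    moreover have "\<exists>c. \<forall>x. x \<in> S \<longleftrightarrow> pair c x \<in> (\<Union>m. - W' m)" if S: "Sigma0 a S" for S
    proof -
      obtain b T where bT: "\<And>n::nat. 1 \<le> b n \<and> b n < a \<and> Sigma0 (b n) (T n)" "S = (\<Union>n. - T n)"
        using Sigma0_D[OF S False] by metis
      define R where "R m = (if b (fst (prod_decode m)) = e (snd (prod_decode m))
          then T (fst (prod_decode m)) else UNIV)" for m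
      have "Sigma0 (e (snd (prod_decode m))) (R m)" for m
        using bT(1)[of "fst (prod_decode m)"] Sigma0_open[OF e(1), of UNIV] by (auto simp: R_def)
      then have "\<forall>m. \<exists>c. \<forall>x. x \<in> R m \<longleftrightarrow> pair c x \<in> W (snd (prod_decode m))"
        using W(2) by blast
      then obtain d where d: "\<And>m x. x \<in> R m \<longleftrightarrow> pair (d m) x \<in> W (snd (prod_decode m))"
        by metis
      obtain c where c: "\<And>m. slot m c = d m" using exists_slots[of d] by blast
      have "S = (\<Union>m. - R m)"
      proof
        show "S \<subseteq> (\<Union>m. - R m)"
        proof
          fix x assume "x \<in> S"
          then obtain n where n: "x \<notin> T n" using bT(2) by auto
          obtain k where "e k = b n" using e_surj bT(1) by blast
          with n have "x \<in> - R (prod_encode (n, k))" by (simp add: R_def)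
          then show "x \<in> (\<Union>m. - R m)" by blast
        qed
        show "(\<Union>m. - R m) \<subseteq> S" by (auto simp: R_def bT(2) split: if_splits)
      qed
      then have "x \<in> S \<longleftrightarrow> pair c x \<in> (\<Union>m. - W' m)" for x
        by (simp add: W'_def c d)
      then show ?thesis by blast
    qed
    ultimately show ?thesis by blast
  qed
qed

lemma Sigma0_eq_Union_ambiguous:
  fixes S :: "baire set"
  assumes "Sigma0 a S"
  shows "\<exists>C :: nat \<Rightarrow> baire set. (\<forall>n. Sigma0 a (C n) \<and> Sigma0 a (- C n)) \<and> S = (\<Union>n. C n)"
proof (cases "a = 1")
  case True
  have "open S" using assms True by (auto elim: Sigma0.cases)
  then obtain c :: "nat \<Rightarrow> nat" where "S = (\<Union>n. basic (c n))" by (rule open_eq_Union_basic)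
  then show ?thesis
    using True open_basic closed_basic by (intro exI[of _ "\<lambda>n. basic (c n)"])
      (auto intro!: Sigma0.intros(1))
next
  case False
  obtain b T where bT: "\<And>n::nat. 1 \<le> b n \<and> b n < a \<and> Sigma0 (b n) (T n)" "S = (\<Union>n. - T n)"
    using Sigma0_D[OF assms False] by metis
  have "Sigma0 a (- T n) \<and> Sigma0 a (- (- T n))" for n
    using bT(1)[of n] Sigma0_Compl Sigma0_mono by (auto simp: less_imp_le)
  then show ?thesis using bT(2) by (intro exI[of _ "\<lambda>n. - T n"]) blast
qed

text \<open>All the ambiguous pieces of all the sets are put into one sequence, and each is diminished by
  its finitely many predecessors.\<close>

lemma Sigma0_reduction:
  fixes S :: "nat \<Rightarrow> baire set"
  assumes S: "\<And>n. Sigma0 a (S n)"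
  shows "\<exists>R. (\<forall>n. Sigma0 a (R n)) \<and> (\<forall>n. R n \<subseteq> S n) \<and> (\<Union>n. R n) = (\<Union>n. S n) \<and> disjoint_family R"
proof -
  have "\<forall>n. \<exists>C :: nat \<Rightarrow> baire set. (\<forall>j. Sigma0 a (C j) \<and> Sigma0 a (- C j)) \<and> S n = (\<Union>j. C j)"
    using Sigma0_eq_Union_ambiguous[OF S] by blast
  then obtain C :: "nat \<Rightarrow> nat \<Rightarrow> baire set"
    where C: "\<And>n j. Sigma0 a (C n j)" "\<And>n j. Sigma0 a (- C n j)" "\<And>n. S n = (\<Union>j. C n j)"
    by metis
  define D where "D m = C (fst (prod_decode m)) (snd (prod_decode m))" for m
  have a: "1 \<le> a" by (rule Sigma0_ge_1[OF S])
  have "Sigma0 a (- (\<Union>k<m. D k))" for m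
  proof (induction m)
    case 0
    show ?case using Sigma0_open[OF a, of UNIV] by simp
  next
    case (Suc m)
    have "- (\<Union>k<Suc m. D k) = - (\<Union>k<m. D k) \<inter> - D m" by (auto simp: less_Suc_eq)
    then show ?case using Suc C(2) by (auto simp: D_def intro: Sigma0_Int)
  qed
  then have dis: "Sigma0 a (disjointed D m)" for m
    using Sigma0_Int[of a "D m"] C(1) by (auto simp: disjointed_def D_def Diff_eq atLeast0LessThan)
  define R where "R n = (\<Union>j. disjointed D (prod_encode (n, j)))" for n
  have "Sigma0 a (R n)" for n
    unfolding R_def by (intro Sigma0_Union dis)
  moreover have "R n \<subseteq> S n" for n
    using disjointed_subset[of D] by (fastforce simp: R_def C(3) D_def)
  moreover have "(\<Union>n. R n) = (\<Union>n. S n)"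
  proof -
    have "(\<Union>n. R n) = (\<Union>m. disjointed D m)"
      unfolding R_def by (auto, metis prod_decode_inverse surj_pair)
    also have "\<dots> = (\<Union>m. D m)" by (rule UN_disjointed_eq)
    also have "\<dots> = (\<Union>n. S n)"
      unfolding D_def C(3) by (auto, metis fst_conv prod_encode_inverse snd_conv)
    finally show ?thesis .
  qed
  moreover have "disjoint_family R"
  proof -
    have "disjointed D (prod_encode (n, j)) \<inter> disjointed D (prod_encode (n', j')) = {}"
      if "n \<noteq> n'" for n n' j j'
      using disjoint_family_disjointed[of D] that unfolding disjoint_family_on_def
      by (auto dest: bspec)
    then show ?thesis unfolding disjoint_family_on_def R_def by blast
  qed
  ultimately show ?thesis by blast
qed

definition tree_reduct :: "(nat list \<Rightarrow> 'x set) \<Rightarrow> (nat list \<Rightarrow> 'x set) \<Rightarrow> bool" where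
  "tree_reduct S V \<longleftrightarrow> V [] = UNIV \<and> (\<forall>t i. V (t @ [i]) \<subseteq> V t \<inter> S (t @ [i]))
     \<and> (\<forall>t. V t \<inter> (\<Union>i. S (t @ [i])) \<subseteq> (\<Union>i. V (t @ [i])))
     \<and> (\<forall>t i j. i \<noteq> j \<longrightarrow> V (t @ [i]) \<inter> V (t @ [j]) = {})"

text \<open>The sets attached to the children of \<open>t\<close> are first cut down to the set already chosen for \<open>t\<close>
  and then reduced. Cutting down makes the family monotone; reducing makes incomparable nodes
  disjoint but keeps the union over the children, so a point of the set for \<open>t\<close> stays in the component
  of \<open>t\<close> only if it lies in no set attached to a child.\<close>

lemma Sigma0_tree_reduction:
  fixes S :: "nat list \<Rightarrow> baire set"
  assumes S: "\<And>t. Sigma0 a (S t)"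
  shows "\<exists>V. (\<forall>t. Sigma0 a (V t)) \<and> tree_reduct S V"
proof -
  have "\<forall>S. \<exists>R. (\<forall>n::nat. Sigma0 a (S n :: baire set)) \<longrightarrow>
      (\<forall>n. Sigma0 a (R n)) \<and> (\<forall>n. R n \<subseteq> S n) \<and> (\<Union>n. R n) = (\<Union>n. S n) \<and> disjoint_family R"
    using Sigma0_reduction by meson
  then obtain red where red: "\<And>S. (\<And>n::nat. Sigma0 a (S n :: baire set)) \<Longrightarrow>
      (\<forall>n. Sigma0 a (red S n)) \<and> (\<forall>n. red S n \<subseteq> S n) \<and> (\<Union>n. red S n) = (\<Union>n. S n)
        \<and> disjoint_family (red S)"
    by metis
  define V where "V t = rec_list UNIV (\<lambda>i s X. red (\<lambda>j. X \<inter> S (rev s @ [j])) i) (rev t)" for t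
  have V_snoc: "V (t @ [i]) = red (\<lambda>j. V t \<inter> S (t @ [j])) i" for t i
    by (simp add: V_def)
  have V: "Sigma0 a (V t)" for t
  proof (induction t rule: rev_induct)
    case Nil
    show ?case using Sigma0_open[OF Sigma0_ge_1[OF S], of UNIV] by (simp add: V_def)
  next
    case (snoc i t)
    then show ?case
      unfolding V_snoc using red[of "\<lambda>j. V t \<inter> S (t @ [j])"] S Sigma0_Int by blast
  qed
  have red': "red (\<lambda>j. V t \<inter> S (t @ [j])) i \<subseteq> V t \<inter> S (t @ [i])"
    "(\<Union>i. red (\<lambda>j. V t \<inter> S (t @ [j])) i) = (\<Union>i. V t \<inter> S (t @ [i]))"
    "disjoint_family (red (\<lambda>j. V t \<inter> S (t @ [j])))" for t i
    using red[of "\<lambda>j. V t \<inter> S (t @ [j])"] Sigma0_Int[OF V S] by auto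
  have "tree_reduct S V"
    unfolding tree_reduct_def
  proof (intro conjI allI impI)
    show "V [] = UNIV" by (simp add: V_def)
    show "V (t @ [i]) \<subseteq> V t \<inter> S (t @ [i])" for t i
      unfolding V_snoc by (rule red')
    show "V t \<inter> (\<Union>i. S (t @ [i])) \<subseteq> (\<Union>i. V (t @ [i]))" for t
      unfolding V_snoc red'(2) by blast
    show "V (t @ [i]) \<inter> V (t @ [j]) = {}" if "i \<noteq> j" for t i j
      unfolding V_snoc using red'(3)[of t] that by (auto simp: disjoint_family_on_def)
  qed
  with V show ?thesis by blast
qed


section \<open>Universal functions\<close>

text \<open>The Borel base and all its shifts have this form.\<close>

definition sigma_base :: "(omega1 \<Rightarrow> omega1) \<Rightarrow> baire base" where
  "sigma_base g = (\<lambda>a. {S. Sigma0 (g a) S})"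

lemma borel_base_eq_sigma_base: "borel_base = sigma_base (oadd 1)"
  by (simp add: borel_base_def sigma_base_def)

lemma shift_sigma_base: "shift b (sigma_base g) = sigma_base (\<lambda>a. g (oadd b a))"
  by (simp add: shift_def sigma_base_def)

lemma shift_restrict_base: "shift b (restrict_base U L) = restrict_base U (shift b L)"
  by (simp add: shift_def restrict_base_def)

text \<open>Subsets \<open>U\<close> of the space occur because in the inductive step the universal function of a label
  has to code a function that is given only on a component.\<close>

definition universal_for :: "(omega1 \<Rightarrow> omega1) \<Rightarrow> 'q trm \<Rightarrow> (baire \<Rightarrow> 'q) \<Rightarrow> bool" where
  "universal_for g u E \<longleftrightarrow> represents (sigma_base g) UNIV u E \<and>
     (\<forall>U A. represents (restrict_base U (sigma_base g)) U u A \<longrightarrow> (\<exists>c. \<forall>x\<in>U. A x = E (pair c x)))"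

lemma strict_prefix_eq_append: "strict_prefix t t' \<Longrightarrow> \<exists>i s. t' = (t @ [i]) @ s"
  by (auto elim: strict_prefixE')

text \<open>The set at a node is made part of the code, reduced uniformly in the code, and the universal
  functions of the labels are glued along the resulting disjoint components. If the code comes from
  a family determining \<open>A\<close>, reduction only shrinks components, so at every point the glued function
  consults a node whose label does determine \<open>A\<close> there.\<close>

lemma exists_universal_Node:
  assumes u: "u = FQ q us \<or> u = FO a us" and g: "1 \<le> g 0"
    and labels: "\<And>t. t \<in> tree u \<Longrightarrow> \<exists>E. universal_for g (label u t) E"
  shows "\<exists>E. universal_for g u E"
proof -
  from labels obtain E where E: "\<And>t. t \<in> tree u \<Longrightarrow> universal_for g (label u t) (E t)" by metis
  obtain W where W: "Sigma0 (g 0) W" "\<And>S. Sigma0 (g 0) S \<Longrightarrow> \<exists>c. \<forall>x. x \<in> S \<longleftrightarrow> pair c x \<in> W"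
    using Sigma0_universal[OF g] by blast
  \<comment> \<open>The slot \<open>(t, False)\<close> of a code describes the set at the node \<open>t\<close>, and the slot \<open>(t, True)\<close>
    describes the function on the component of \<open>t\<close>.\<close>
  define sub where "sub i z = pair (slot i (left z)) (right z)" for i :: "nat list \<times> bool" and z
  have cont: "continuous_on UNIV (sub i)" for i
    unfolding sub_def by (rule continuous_on_pair_slot)
  \<comment> \<open>Empty sets outside the tree let all strings be treated as nodes in the reduction: they give no
    new children.\<close>
  define S where "S t = (if t \<in> tree u then sub (t, False) -` W else {})" for t
  have S: "Sigma0 (g 0) (S t)" for t
    using Sigma0_vimage[OF W(1) cont] Sigma0_open[OF g, of "{}"] by (simp add: S_def)
  obtain V where Sigma0_V: "\<And>t. Sigma0 (g 0) (V t)" and "tree_reduct S V"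
    using Sigma0_tree_reduction[of "g 0" S, OF S] by blast
  then have V: "V [] = UNIV" "\<And>t i. V (t @ [i]) \<subseteq> V t \<inter> S (t @ [i])"
    "\<And>t. V t \<inter> (\<Union>i. S (t @ [i])) \<subseteq> (\<Union>i. V (t @ [i]))"
    "\<And>t i j. i \<noteq> j \<Longrightarrow> V (t @ [i]) \<inter> V (t @ [j]) = {}"
    by (simp_all only: tree_reduct_def) blast+
  have V_append: "V (t @ s) \<subseteq> V t" for t s
  proof (induction s rule: rev_induct)
    case (snoc i s)
    then show ?case using V(2)[of "t @ s" i] by auto
  qed simp
  let ?K = "\<lambda>t. component (tree u) V t"
  have K_iff: "z \<in> ?K t \<longleftrightarrow> z \<in> V t \<and> (\<forall>i. z \<notin> V (t @ [i]))" if "t \<in> tree u" for z t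
  proof -
    have child: "t @ [i] \<in> tree u" if "z \<in> V (t @ [i])" for i
      using V(2)[of t i] that by (auto simp: S_def split: if_splits)
    show ?thesis
    proof
      assume z: "z \<in> ?K t"
      have "z \<notin> V (t @ [i])" for i
      proof
        assume i: "z \<in> V (t @ [i])"
        with child have "V (t @ [i]) \<in> {V t' | t'. t' \<in> tree u \<and> strict_prefix t t'}"
          by (intro CollectI exI[of _ "t @ [i]"]) (auto simp: strict_prefix_def)
        with z i show False unfolding component_def by blast
      qed
      with z show "z \<in> V t \<and> (\<forall>i. z \<notin> V (t @ [i]))" by (simp add: component_def)
    next
      assume z: "z \<in> V t \<and> (\<forall>i. z \<notin> V (t @ [i]))"
      have "z \<notin> V t'" if t': "strict_prefix t t'" for t'
      proof -
        obtain i s where "t' = (t @ [i]) @ s"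
          using strict_prefix_eq_append[OF t'] by blast
        then show ?thesis using z V_append[of "t @ [i]" s] by blast
      qed
      then show "z \<in> ?K t" using z by (auto simp: component_def)
    qed
  qed
  have K_unique: "t = t'" if "t \<in> tree u" "t' \<in> tree u" "z \<in> ?K t" "z \<in> ?K t'" for z t t'
  proof (rule ccontr)
    assume ne: "t \<noteq> t'"
    have z: "z \<in> V t" "z \<in> V t'" using that by (auto simp: component_def)
    consider "strict_prefix t t'" | "strict_prefix t' t" | "parallel t t'"
      using ne by (metis parallelI strict_prefixI)
    then show False
    proof cases
      case 3
      then obtain p i s j s' where p: "i \<noteq> j" "t = p @ i # s" "t' = p @ j # s'"
        using parallel_decomp by blast
      then have "z \<in> V (p @ [i])" "z \<in> V (p @ [j])"
        using z V_append[of "p @ [i]" s] V_append[of "p @ [j]" s'] by auto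
      then show False using V(4)[OF p(1)] by blast
    qed (use that z in \<open>auto simp: component_def\<close>)
  qed
  have K_cover: "\<exists>t\<in>tree u. z \<in> ?K t" for z
  proof -
    obtain t where t: "t \<in> tree u" "z \<in> V t" "\<And>i. t @ [i] \<in> tree u \<Longrightarrow> z \<notin> V (t @ [i])"
      using tree_maximal_node[of "\<lambda>t. z \<in> V t" u] V(1) by auto
    have "z \<notin> V (t @ [i])" for i
      using t(3)[of i] V(2)[of t i] by (auto simp: S_def split: if_splits)
    then show ?thesis using t K_iff by blast
  qed
  define B where "B z = (let t = SOME t. t \<in> tree u \<and> z \<in> ?K t in E t (sub (t, True) z))" for z
  have B: "B z = E t (sub (t, True) z)" if "t \<in> tree u" "z \<in> ?K t" for z t
  proof -
    have "(SOME t. t \<in> tree u \<and> z \<in> ?K t) = t"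
      by (rule some_equality) (use that K_unique in blast)+
    then show ?thesis by (simp add: B_def)
  qed
  have "represents (sigma_base g) UNIV u B"
  proof (rule represents_NodeI[OF u])
    show "monotone_family (tree u) V"
      using V_append by (auto simp: monotone_family_def prefix_def)
    show "V t \<in> sigma_base g 0" if "t \<in> tree u" for t
      using Sigma0_V by (simp add: sigma_base_def)
    show "V [] = UNIV" by (rule V)
    fix t assume t: "t \<in> tree u"
    then have "represents (sigma_base g) UNIV (label u t) (E t)"
      using E by (simp add: universal_for_def)
    then show "represents (restrict_base (?K t) (sigma_base g)) (?K t) (label u t) B"
    proof (rule represents_pullback[where f = "sub (t, True)"])
      fix b R assume "R \<in> sigma_base g b"
      then have "sub (t, True) -` R \<in> sigma_base g b"
        unfolding sigma_base_def using Sigma0_vimage[OF _ cont] by blast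
      then show "?K t \<inter> sub (t, True) -` R \<in> restrict_base (?K t) (sigma_base g) b"
        unfolding restrict_base_def by (rule imageI)
    qed (simp_all add: B[OF t])
  qed
  moreover have "\<exists>c. \<forall>x\<in>U. A x = B (pair c x)"
    if A: "represents (restrict_base U (sigma_base g)) U u A" for U A
  proof -
    from represents_NodeE[OF u A]
    obtain D where D: "monotone_family (tree u) D"
      "\<And>t. t \<in> tree u \<Longrightarrow> D t \<in> restrict_base U (sigma_base g) 0" "D [] = U"
      "\<And>t. t \<in> tree u \<Longrightarrow> represents (restrict_base (component (tree u) D t)
          (restrict_base U (sigma_base g))) (component (tree u) D t) (label u t) A"
      by blast
    have "\<exists>c. \<forall>x\<in>U. x \<in> D t \<longleftrightarrow> pair c x \<in> W" if t: "t \<in> tree u" for t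
    proof -
      obtain R where "Sigma0 (g 0) R" "D t = U \<inter> R"
        using D(2)[OF t] by (auto simp: restrict_base_def sigma_base_def)
      then show ?thesis using W(2) by blast
    qed
    then obtain d where d: "\<And>t x. t \<in> tree u \<Longrightarrow> x \<in> U \<Longrightarrow> x \<in> D t \<longleftrightarrow> pair (d t) x \<in> W"
      by metis
    have "\<exists>c. \<forall>x\<in>component (tree u) D t. A x = E t (pair c x)" if t: "t \<in> tree u" for t
    proof -
      have "D t \<subseteq> U"
        using D(2)[OF t] by (auto simp: restrict_base_def)
      then have "component (tree u) D t \<subseteq> U" by (auto simp: component_def)
      then show ?thesis
        using D(4)[OF t] E[OF t] by (simp add: restrict_base_restrict_base universal_for_def)
    qed
    then obtain d' where d': "\<And>t x. t \<in> tree u \<Longrightarrow> x \<in> component (tree u) D t \<Longrightarrow>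
        A x = E t (pair (d' t) x)"
      by metis
    obtain c where c: "\<And>i. slot i c = (case i of (t, b) \<Rightarrow> if b then d' t else d t)"
      using exists_slots[of "\<lambda>i. case i of (t, b) \<Rightarrow> if b then d' t else d t"] by metis
    have sub_c: "sub (t, False) (pair c x) = pair (d t) x" "sub (t, True) (pair c x) = pair (d' t) x"
      for t x by (simp_all add: sub_def c)
    have "A x = B (pair c x)" if x: "x \<in> U" for x
    proof -
      have S_iff: "pair c x \<in> S t \<longleftrightarrow> x \<in> D t" if "t \<in> tree u" for t
        using that d x by (simp add: S_def sub_c)
      obtain t where t: "t \<in> tree u" "pair c x \<in> ?K t" using K_cover by blast
      then have V_t: "pair c x \<in> V t" "\<And>i. pair c x \<notin> V (t @ [i])" using K_iff by blast+
      \<comment> \<open>The component of the reduced family is contained in that of \<open>D\<close>.\<close>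
      have "x \<in> D t"
      proof (cases t rule: rev_cases)
        case Nil
        then show ?thesis using x D(3) by simp
      next
        case (snoc s i)
        then show ?thesis using V(2)[of s i] V_t(1) S_iff[OF t(1)] by auto
      qed
      moreover have "x \<notin> D t'" if "t' \<in> tree u" and t'_above: "strict_prefix t t'" for t'
      proof -
        obtain i s where t': "t' = (t @ [i]) @ s"
          using strict_prefix_eq_append[OF t'_above] by blast
        then have child: "t @ [i] \<in> tree u" using that(1) tree_prefix_closed by blast
        have "pair c x \<notin> S (t @ [i])" using V(3)[of t] V_t by blast
        then have "x \<notin> D (t @ [i])" using S_iff[OF child] by simp
        moreover have "D t' \<subseteq> D (t @ [i])"
          using D(1) child that(1) unfolding t' monotone_family_def by (meson prefixI)
        ultimately show ?thesis by blast
      qed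
      ultimately have "x \<in> component (tree u) D t" by (auto simp: component_def)
      then show ?thesis using d'[OF t(1)] B[OF t] by (simp add: sub_c)
    qed
    then show ?thesis by blast
  qed
  ultimately show ?thesis by (auto simp: universal_for_def)
qed

lemma exists_universal: "(\<And>a. 1 \<le> g a) \<Longrightarrow> \<exists>E. universal_for g u E"
proof (induction u arbitrary: g rule: trm_label_induct)
  case (Const q g)
  have "universal_for g (Const q) (\<lambda>_. q)"
    by (simp add: universal_for_def represents_Const)
  then show ?case by blast
next
  case (Sh a u g)
  obtain E where "universal_for (\<lambda>b. g (oadd (omega_pow a) b)) u E"
    using Sh.IH[of "\<lambda>b. g (oadd (omega_pow a) b)", OF Sh.prems] by (rule exE)
  then have "universal_for g (Sh a u) E"
    unfolding universal_for_def represents_Sh shift_restrict_base shift_sigma_base .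
  then show ?case by (rule exI[of _ E])
next
  case (Node u q a us g)
  show ?case
    using Node.hyps Node.prems Node.IH[OF _ Node.prems] by (rule exists_universal_Node)
qed

theorem corollary4:
  fixes le :: "'q \<Rightarrow> 'q \<Rightarrow> bool" and u :: "'q trm"
  assumes "reflp le" and "transp le"
  shows "\<exists>B \<in> level (borel_base :: baire base) u.
           \<forall>A \<in> level (borel_base :: baire base) u. wadge_le le A B"
proof -
  have level: "A \<in> level borel_base u \<longleftrightarrow> represents (sigma_base (oadd 1)) UNIV u A" for A :: "baire \<Rightarrow> 'q"
    by (simp add: level_def represents_def borel_base_eq_sigma_base)
  obtain B where B: "universal_for (oadd 1) u B"
    using exists_universal[of "oadd 1" u, OF oadd_bounds(1)] by (rule exE)
  have "wadge_le le A B" if "A \<in> level borel_base u" for A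
  proof -
    have "represents (restrict_base UNIV (sigma_base (oadd 1))) UNIV u A"
      using that by (simp add: level restrict_base_def)
    then obtain c where c: "\<And>x. A x = B (pair c x)"
      using B unfolding universal_for_def by blast
    have "continuous_on UNIV (pair c)"
      by (intro continuous_on_pair continuous_on_const continuous_on_id)
    moreover have "le (A x) (B (pair c x))" for x
      using c assms(1) by (simp add: reflpD)
    ultimately show ?thesis by (auto simp: wadge_le_def)
  qed
  moreover have "B \<in> level borel_base u"
    using B by (simp add: level universal_for_def)
  ultimately show ?thesis by blast
qed

end
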